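(* A virtual knot group is left-orderable if and only if it is circularly orderable. That is, for every virtual knot $K$, the group $G_K$ of $K$ is left-orderable if and only if it is circularly orderable.
   Context: The group $G_K$ of a virtual knot $K$ is the group with Wirtinger presentation read from a virtual knot diagram of $K$: one generator for each arc (running from one classical under-crossing to the next, ignoring virtual crossings) and one Wirtinger relation for each classical crossing, with no relation at virtual crossings. Concretely, traversing a diagram with $n\ge1$ classical crossings, it is $$G_K=\langle x_1,\dots,x_n\mid x_{i+1}=x_{j(i)}^{-\varepsilon_i}\,x_i\,x_{j(i)}^{\varepsilon_i},\ i=1,\dots,n\rangle,$$ with indices modulo $n$, where $x_{j(i)}$ is the generator of the over-crossing arc at the $i$-th under-crossing and $\varepsilon_i\in\{1,-1\}$ is determined by the sign of that crossing; for a diagram without classical crossings $G_K=\mathbb Z$. A group is left-orderable if it admits a strict total order invariant under left multiplication. A group $G$ is circularly orderable if there is a map $c\colon G^3\to\{-1,0,1\}$ with $c(g_1,g_2,g_3)=0$ exactly when $g_1,g_2,g_3$ are not pairwise distinct, $c(g_2,g_3,g_4)-c(g_1,g_3,g_4)+c(g_1,g_2,g_4)-c(g_1,g_2,g_3)=0$ for all $g_i$, and $c(gg_1,gg_2,gg_3)=c(g_1,g_2,g_3)$ for all $g,g_i\in G$. *)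

theory Defs
  imports "HOL-Algebra.Elementary_Groups"
begin

section \<open>Left-orderable and circularly orderable groups\<close>

definition left_orderable :: "('a, 'b) monoid_scheme \<Rightarrow> bool" where
  "left_orderable G \<longleftrightarrow>
    (\<exists>lt :: 'a \<Rightarrow> 'a \<Rightarrow> bool.
      irreflp_on (carrier G) lt \<and> transp_on (carrier G) lt \<and> totalp_on (carrier G) lt \<and>
      (\<forall>g\<in>carrier G. \<forall>x\<in>carrier G. \<forall>y\<in>carrier G.
        lt x y \<longrightarrow> lt (g \<otimes>\<^bsub>G\<^esub> x) (g \<otimes>\<^bsub>G\<^esub> y)))"

definition circularly_orderable :: "('a, 'b) monoid_scheme \<Rightarrow> bool" where
  "circularly_orderable G \<longleftrightarrow>
    (\<exists>c :: 'a \<Rightarrow> 'a \<Rightarrow> 'a \<Rightarrow> int.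
      (\<forall>x\<in>carrier G. \<forall>y\<in>carrier G. \<forall>z\<in>carrier G.
        c x y z \<in> {-1, 0, 1} \<and>
        (c x y z = 0 \<longleftrightarrow> \<not> (x \<noteq> y \<and> x \<noteq> z \<and> y \<noteq> z))) \<and>
      (\<forall>g1\<in>carrier G. \<forall>g2\<in>carrier G. \<forall>g3\<in>carrier G. \<forall>g4\<in>carrier G.
        c g2 g3 g4 - c g1 g3 g4 + c g1 g2 g4 - c g1 g2 g3 = 0) \<and>
      (\<forall>g\<in>carrier G. \<forall>x\<in>carrier G. \<forall>y\<in>carrier G. \<forall>z\<in>carrier G.
        c (g \<otimes>\<^bsub>G\<^esub> x) (g \<otimes>\<^bsub>G\<^esub> y) (g \<otimes>\<^bsub>G\<^esub> z) = c x y z))"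


section \<open>Groups given by generators and relations\<close>

text \<open>The letter \<open>(x, True)\<close> stands for the generator \<open>x\<close>, and \<open>(x, False)\<close> for its inverse.\<close>

type_synonym 'g word = "('g \<times> bool) list"

definition words :: "'g set \<Rightarrow> 'g word set" where
  "words X = lists (X \<times> UNIV)"

text \<open>The least congruence on the words over \<open>X\<close> which contains free cancellation and
  identifies \<open>l\<close> with \<open>r\<close> for every relation \<open>l = r\<close>, given as a pair \<open>(l, r) \<in> R\<close>.\<close>

inductive_set word_cong :: "'g set \<Rightarrow> ('g word \<times> 'g word) set \<Rightarrow> ('g word \<times> 'g word) set"
  for X :: "'g set" and R :: "('g word \<times> 'g word) set" where
  refl: "u \<in> words X \<Longrightarrow> (u, u) \<in> word_cong X R"
| sym: "(u, v) \<in> word_cong X R \<Longrightarrow> (v, u) \<in> word_cong X R"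
| trans: "(u, v) \<in> word_cong X R \<Longrightarrow> (v, w) \<in> word_cong X R \<Longrightarrow> (u, w) \<in> word_cong X R"
| cancel: "x \<in> X \<Longrightarrow> u \<in> words X \<Longrightarrow> v \<in> words X \<Longrightarrow>
    (u @ [(x, b), (x, \<not> b)] @ v, u @ v) \<in> word_cong X R"
| relation: "(l, r) \<in> R \<Longrightarrow> l \<in> words X \<Longrightarrow> r \<in> words X \<Longrightarrow> u \<in> words X \<Longrightarrow> v \<in> words X \<Longrightarrow>
    (u @ l @ v, u @ r @ v) \<in> word_cong X R"

definition presented_group ::
  "'g set \<Rightarrow> ('g word \<times> 'g word) set \<Rightarrow> 'g word set monoid" where
  "presented_group X R =
    \<lparr>carrier = words X // word_cong X R,
     monoid.mult = (\<lambda>A B. \<Union>a\<in>A. \<Union>b\<in>B. word_cong X R `` {a @ b}),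
     one = word_cong X R `` {[]}\<rparr>"

lemma words_simps [simp]:
  "[] \<in> words X"
  "(p # u) \<in> words X \<longleftrightarrow> fst p \<in> X \<and> u \<in> words X"
  "(u @ v) \<in> words X \<longleftrightarrow> u \<in> words X \<and> v \<in> words X"
  by (auto simp: words_def lists_eq_set mem_Times_iff)

lemma word_cong_in_words: "(u, v) \<in> word_cong X R \<Longrightarrow> u \<in> words X \<and> v \<in> words X"
  by (induction rule: word_cong.induct) auto

lemma equiv_word_cong: "equiv (words X) (word_cong X R)"
proof (rule equivI)
  show "word_cong X R \<subseteq> words X \<times> words X"
    using word_cong_in_words by fast
qed (auto intro: refl_onI symI transI word_cong.refl word_cong.sym word_cong.trans)

lemma word_cong_context:
  assumes "(u, v) \<in> word_cong X R" "a \<in> words X" "b \<in> words X"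
  shows "(a @ u @ b, a @ v @ b) \<in> word_cong X R"
  using assms(1)
proof (induction rule: word_cong.induct)
  case (refl u)
  then show ?case using assms(2,3) by (intro word_cong.refl) simp
next
  case (cancel x u v c)
  then show ?case
    using assms word_cong.cancel[of x X "a @ u" "v @ b" c R] by simp
next
  case (relation l r u v)
  then show ?case
    using assms word_cong.relation[of l r R X "a @ u" "v @ b"] by simp
qed (blast intro: word_cong.sym word_cong.trans)+

lemma word_cong_append:
  assumes "(u, u') \<in> word_cong X R" "(v, v') \<in> word_cong X R"
  shows "(u @ v, u' @ v') \<in> word_cong X R"
  using word_cong_context[OF assms(1), of "[]" v] word_cong_context[OF assms(2), of u' "[]"]
    word_cong_in_words[OF assms(1)] word_cong_in_words[OF assms(2)]
  by (auto intro: word_cong.trans)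

lemma carrier_presented_group:
  "carrier (presented_group X R) = {word_cong X R `` {u} | u. u \<in> words X}"
  by (auto simp: presented_group_def quotient_def)

lemma one_presented_group: "\<one>\<^bsub>presented_group X R\<^esub> = word_cong X R `` {[]}"
  by (simp add: presented_group_def)

lemma class_eq_iff:
  assumes "u \<in> words X" "v \<in> words X"
  shows "word_cong X R `` {u} = word_cong X R `` {v} \<longleftrightarrow> (u, v) \<in> word_cong X R"
  using eq_equiv_class_iff[OF equiv_word_cong assms] .

lemma mult_presented_group:
  assumes "u \<in> words X" "v \<in> words X"
  shows "(word_cong X R `` {u}) \<otimes>\<^bsub>presented_group X R\<^esub> (word_cong X R `` {v})
    = word_cong X R `` {u @ v}"
proof -
  let ?E = "word_cong X R"
  have "?E `` {a @ b} = ?E `` {u @ v}" if "a \<in> ?E `` {u}" "b \<in> ?E `` {v}" for a b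
    using equiv_class_eq[OF equiv_word_cong word_cong_append[of u a X R v b]] that by simp
  then have "(\<Union>a\<in>?E `` {u}. \<Union>b\<in>?E `` {v}. ?E `` {a @ b})
      = (\<Union>a\<in>?E `` {u}. \<Union>b\<in>?E `` {v}. ?E `` {u @ v})"
    by (intro SUP_cong HOL.refl)
  also have "\<dots> = ?E `` {u @ v}"
  proof -
    have "u \<in> ?E `` {u}" "v \<in> ?E `` {v}" using assms by (simp_all add: word_cong.refl)
    then show ?thesis by blast
  qed
  finally have "(\<Union>a\<in>?E `` {u}. \<Union>b\<in>?E `` {v}. ?E `` {a @ b}) = ?E `` {u @ v}" .
  then show ?thesis by (simp add: presented_group_def)
qed

definition inv_word :: "'g word \<Rightarrow> 'g word" where
  "inv_word u = rev (map (\<lambda>(x, b). (x, \<not> b)) u)"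

lemma inv_word_in_words: "u \<in> words X \<Longrightarrow> inv_word u \<in> words X"
  by (induction u) (auto simp: inv_word_def)

lemma inv_word_left: "u \<in> words X \<Longrightarrow> (inv_word u @ u, []) \<in> word_cong X R"
proof (induction u)
  case Nil
  then show ?case by (simp add: inv_word_def word_cong.refl)
next
  case (Cons p u)
  obtain x b where p: "p = (x, b)" by (cases p)
  have "inv_word (p # u) @ p # u = inv_word u @ [(x, \<not> b), (x, \<not> \<not> b)] @ u"
    by (simp add: inv_word_def p)
  also have "(\<dots>, inv_word u @ u) \<in> word_cong X R"
    using Cons.prems inv_word_in_words[of u X] p by (intro word_cong.cancel) auto
  finally show ?case
    by (rule word_cong.trans) (use Cons in simp)
qed

theorem group_presented_group: "group (presented_group X R)"
proof (rule groupI)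
  fix A assume "A \<in> carrier (presented_group X R)"
  then obtain u where "u \<in> words X" and A: "A = word_cong X R `` {u}"
    by (auto simp: carrier_presented_group)
  then have "inv_word u \<in> words X" "word_cong X R `` {inv_word u @ u} = word_cong X R `` {[]}"
    using inv_word_in_words[of u X] inv_word_left[of u X R] by (auto simp: class_eq_iff)
  then show "\<exists>B\<in>carrier (presented_group X R).
      B \<otimes>\<^bsub>presented_group X R\<^esub> A = \<one>\<^bsub>presented_group X R\<^esub>"
    using \<open>u \<in> words X\<close>
    by (intro bexI[of _ "word_cong X R `` {inv_word u}"])
      (auto simp: A mult_presented_group one_presented_group carrier_presented_group)
next
  fix A B assume "A \<in> carrier (presented_group X R)" "B \<in> carrier (presented_group X R)"
  then obtain u v where "u \<in> words X" "A = word_cong X R `` {u}"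
      "v \<in> words X" "B = word_cong X R `` {v}"
    by (auto simp: carrier_presented_group)
  then show "A \<otimes>\<^bsub>presented_group X R\<^esub> B \<in> carrier (presented_group X R)"
    by (auto simp: carrier_presented_group mult_presented_group intro!: exI[of _ "u @ v"])
next
  show "\<one>\<^bsub>presented_group X R\<^esub> \<in> carrier (presented_group X R)"
    by (auto simp: carrier_presented_group one_presented_group intro!: exI[of _ "[]"])
next
  fix A B C
  assume "A \<in> carrier (presented_group X R)" "B \<in> carrier (presented_group X R)"
    "C \<in> carrier (presented_group X R)"
  then obtain u v w where "u \<in> words X" "A = word_cong X R `` {u}"
      "v \<in> words X" "B = word_cong X R `` {v}" "w \<in> words X" "C = word_cong X R `` {w}"
    unfolding carrier_presented_group by blast
  then show "A \<otimes>\<^bsub>presented_group X R\<^esub> B \<otimes>\<^bsub>presented_group X R\<^esub> C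
      = A \<otimes>\<^bsub>presented_group X R\<^esub> (B \<otimes>\<^bsub>presented_group X R\<^esub> C)"
    by (simp add: mult_presented_group)
next
  fix A assume "A \<in> carrier (presented_group X R)"
  then obtain u where "u \<in> words X" "A = word_cong X R `` {u}"
    unfolding carrier_presented_group by blast
  then show "\<one>\<^bsub>presented_group X R\<^esub> \<otimes>\<^bsub>presented_group X R\<^esub> A = A"
    by (simp add: mult_presented_group one_presented_group)
qed


section \<open>Virtual knot diagrams and their groups\<close>

text \<open>
  A virtual knot diagram is encoded by its signed Gauss code: the cyclic sequence in which an
  oriented traversal, from some base point, runs over and under the classical crossings, together
  with their signs.  Virtual crossings are not recorded.  Every signed Gauss code is that of a
  virtual knot diagram, and the code determines the diagram up to detour moves (moves of strands
  which have only virtual crossings), which do not change the virtual knot or the Wirtinger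
  presentation.
\<close>

datatype 'c passage = is_over: Over 'c | is_under: Under 'c

definition gauss_code :: "'c passage list \<Rightarrow> ('c \<Rightarrow> int) \<Rightarrow> bool" where
  "gauss_code w sgn_of \<longleftrightarrow>
    distinct w \<and>
    (\<forall>c. Over c \<in> set w \<longleftrightarrow> Under c \<in> set w) \<and>
    (\<forall>c. Under c \<in> set w \<longrightarrow> sgn_of c \<in> {1, -1})"

definition num_crossings :: "'c passage list \<Rightarrow> nat" where
  "num_crossings w = length (filter is_under w)"

text \<open>The arc on which the traversal arrives at position \<open>p\<close> of \<open>w\<close>.  Arcs are numbered
  consecutively from the one containing the base point, and the arc after the last
  under-crossing is again arc \<open>0\<close>.\<close>

definition arc_at :: "'c passage list \<Rightarrow> nat \<Rightarrow> nat" where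
  "arc_at w p = num_crossings (take p w) mod num_crossings w"

text \<open>A diagram without classical crossings has a single, closed arc.\<close>

definition arcs :: "'c passage list \<Rightarrow> nat set" where
  "arcs w = {..<max 1 (num_crossings w)}"

definition letter :: "'g \<Rightarrow> int \<Rightarrow> 'g \<times> bool" where
  "letter x e = (x, e = 1)"

text \<open>At position \<open>p\<close> the traversal passes under the crossing \<open>c\<close>, from arc \<open>arc_at w p\<close> to
  arc \<open>arc_at w (Suc p)\<close>; the over-crossing arc is the one containing the position \<open>q\<close>.
  The exponent is taken to be the sign of the crossing; the opposite convention gives the group of
  the code with all signs changed.\<close>

definition wirtinger_relations ::
  "'c passage list \<Rightarrow> ('c \<Rightarrow> int) \<Rightarrow> (nat word \<times> nat word) set" where
  "wirtinger_relations w sgn_of =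
    {([letter (arc_at w (Suc p)) 1],
      [letter (arc_at w q) (- sgn_of c), letter (arc_at w p) 1, letter (arc_at w q) (sgn_of c)])
     | p q c. p < length w \<and> q < length w \<and> w ! p = Under c \<and> w ! q = Over c}"

definition virtual_knot_group ::
  "'c passage list \<Rightarrow> ('c \<Rightarrow> int) \<Rightarrow> nat word set monoid" where
  "virtual_knot_group w sgn_of = presented_group (arcs w) (wirtinger_relations w sgn_of)"

text \<open>Without classical crossings, the presentation above is that of the integers.\<close>

definition exponent_sum :: "'g word \<Rightarrow> int" where
  "exponent_sum u = (\<Sum>(x, b)\<leftarrow>u. if b then 1 else -1)"

lemma exponent_sum_simps [simp]:
  "exponent_sum [] = 0"
  "exponent_sum ((x, b) # u) = (if b then 1 else -1) + exponent_sum u"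
  "exponent_sum (u @ v) = exponent_sum u + exponent_sum v"
  by (auto simp: exponent_sum_def)

lemma exponent_sum_word_cong: "(u, v) \<in> word_cong X {} \<Longrightarrow> exponent_sum u = exponent_sum v"
  by (induction rule: word_cong.induct) auto

lemma word_cong_power_word:
  assumes "u \<in> words {x}"
  shows "(u, replicate (nat \<bar>exponent_sum u\<bar>) (x, 0 < exponent_sum u)) \<in> word_cong {x} {}"
  using assms
proof (induction u)
  case Nil
  then show ?case by (simp add: word_cong.refl)
next
  case (Cons p u)
  obtain b where p: "p = (x, b)" using Cons.prems by (cases p) auto
  define n where "n = exponent_sum u"
  define e where "e = (if b then 1 else -1 :: int)"
  let ?can = "\<lambda>n :: int. replicate (nat \<bar>n\<bar>) (x, 0 < n)"
  have can: "?can m \<in> words {x}" for m by (auto simp: words_def)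
  have "(p # u, p # ?can n) \<in> word_cong {x} {}"
    using word_cong_context[OF Cons.IH, of "[p]" "[]"] Cons.prems by (simp add: n_def)
  moreover have "(p # ?can n, ?can (e + n)) \<in> word_cong {x} {}"
  proof (cases "n = 0 \<or> (0 < n \<longleftrightarrow> b)")
    case True
    then have "nat \<bar>e + n\<bar> = Suc (nat \<bar>n\<bar>)" "0 < e + n \<longleftrightarrow> b" "n \<noteq> 0 \<longrightarrow> (0 < n \<longleftrightarrow> b)"
      by (auto simp: e_def)
    then have "p # ?can n = ?can (e + n)" by (cases "n = 0") (auto simp: p)
    then show ?thesis using can word_cong.refl by metis
  next
    case False
    then have "nat \<bar>n\<bar> = Suc (nat \<bar>e + n\<bar>)" "(0 < n) = (\<not> b)"
      "e + n \<noteq> 0 \<longrightarrow> (0 < e + n) = (\<not> b)"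
      by (auto simp: e_def)
    then have "p # ?can n = [] @ [(x, b), (x, \<not> b)] @ ?can (e + n)"
      by (cases "e + n = 0") (auto simp: p)
    then show ?thesis using word_cong.cancel[of x "{x}" "[]" "?can (e + n)" b "{}"] can by simp
  qed
  moreover have "exponent_sum (p # u) = e + n" by (simp add: p e_def n_def)
  ultimately show ?case by (metis word_cong.trans)
qed

lemma exponent_sum_replicate [simp]:
  "exponent_sum (replicate n (x, b)) = (if b then int n else - int n)"
  by (induction n) auto

theorem virtual_knot_group_no_crossings: "virtual_knot_group [] sgn_of \<cong> integer_group"
proof -
  let ?C = "word_cong {0 :: nat} {}"
  let ?G = "virtual_knot_group [] sgn_of"
  have G: "?G = presented_group {0} {}"
    by (auto simp: virtual_knot_group_def arcs_def num_crossings_def wirtinger_relations_def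
        lessThan_Suc)
  define f where "f A = (THE n. \<exists>u\<in>A. n = exponent_sum u)" for A :: "nat word set"
  have f: "f (?C `` {u}) = exponent_sum u" if "u \<in> words {0}" for u
  proof -
    have "u \<in> ?C `` {u}" using that by (simp add: word_cong.refl)
    moreover have "exponent_sum v = exponent_sum u" if "v \<in> ?C `` {u}" for v
      using that exponent_sum_word_cong by fastforce
    ultimately show ?thesis unfolding f_def by (intro the_equality) blast+
  qed
  have "f \<in> hom ?G integer_group"
    by (rule homI) (auto simp: G carrier_presented_group mult_presented_group f)
  moreover have "inj_on f (carrier ?G)"
  proof (rule inj_onI)
    fix A B assume AB: "A \<in> carrier ?G" "B \<in> carrier ?G" "f A = f B"
    obtain u v where uv: "u \<in> words {0}" "A = ?C `` {u}" "v \<in> words {0}" "B = ?C `` {v}"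
      using AB by (auto simp: G carrier_presented_group)
    then have "exponent_sum u = exponent_sum v" using AB f by simp
    then have "(u, v) \<in> ?C"
      using word_cong_power_word[OF uv(1)] word_cong_power_word[OF uv(3)]
      by (metis word_cong.sym word_cong.trans)
    then show "A = B" using uv by (simp add: class_eq_iff)
  qed
  moreover have "f ` carrier ?G = UNIV"
  proof -
    have "n \<in> f ` carrier ?G" for n :: int
    proof (rule image_eqI)
      let ?u = "replicate (nat \<bar>n\<bar>) (0 :: nat, 0 < n)"
      have u: "?u \<in> words {0}" by (auto simp: words_def)
      then show "?C `` {?u} \<in> carrier ?G" by (auto simp: G carrier_presented_group)
      show "n = f (?C `` {?u})" using f[OF u] by simp
    qed
    then show ?thesis by auto
  qed
  ultimately have "f \<in> iso ?G integer_group"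
    by (simp add: iso_def bij_betw_def)
  then show ?thesis by (auto simp: is_iso_def)
qed

end

theory Submission
  imports Defs
begin

text \<open>
  A left order \<open><\<close> yields a circular order in every group: the map which sends \<open>(x, y)\<close> to \<open>1\<close>,
  \<open>-1\<close> or \<open>0\<close> according to whether \<open>x < y\<close>, \<open>y < x\<close> or \<open>x = y\<close> has as its coboundary the
  circular order in which \<open>x < y < z\<close> are positively arranged.

  Conversely, let \<open>G\<close> be circularly ordered.  Unrolling the circle gives a central extension
  \<open>0 \<rightarrow> \<int> \<rightarrow> E \<rightarrow> G \<rightarrow> 1\<close>, given by a cocycle with values in \<open>{0, 1}\<close>, and \<open>E\<close> is left-ordered
  lexicographically (\<open>left_orderable_ext\<close>).  So it is enough to find a homomorphic section
  \<open>G \<rightarrow> E\<close>, which embeds \<open>G\<close> in a left-orderable group.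

  The key fact (\<open>ext_eq_of_conjugate\<close>) is that two conjugate elements of \<open>E\<close> over the same element
  of \<open>G\<close> are equal.  They differ by a central \<open>k \<in> \<int>\<close>; their squares are conjugate and
  differ by \<open>2 k\<close>; but conjugation by an element \<open>l\<close> can change the integer coordinate only by the
  difference of two values of the cocycle, so \<open>\<bar>2 k\<bar> \<le> 1\<close> and \<open>k = 0\<close>.  In topological terms, the
  Euler class of a circular order vanishes on tori.  Hence each conjugacy class of \<open>E\<close> is mapped
  bijectively to a conjugacy class of \<open>G\<close>.

  In a Wirtinger presentation of a knot group, each relation equates a generator with a conjugate
  of a generator, and along the knot all generators become conjugate in \<open>G\<close>.  Fix one conjugacy
  class \<open>K\<close> of \<open>E\<close> over their common class, and lift each generator to its unique lift in \<open>K\<close>.  The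
  two sides of a relation, evaluated at the lifts, both lie in \<open>K\<close> and have the same image in \<open>G\<close>,
  so they are equal.  The relations therefore hold in \<open>E\<close>, and the lifts define the section.
  \<open>left_orderable_if_generators_conjugate\<close> carries this out for an arbitrary presentation with
  conjugate generators and relations of this form.
\<close>

section \<open>Left-orderable groups\<close>

lemma left_orderable_imp_circularly_orderable:
  assumes "group G" "left_orderable G"
  shows "circularly_orderable G"
proof -
  interpret group G by fact
  obtain lt :: "'a \<Rightarrow> 'a \<Rightarrow> bool" where irr: "irreflp_on (carrier G) lt"
    and tr: "transp_on (carrier G) lt" and tot: "totalp_on (carrier G) lt"
    and inv: "\<And>g x y. \<lbrakk>g \<in> carrier G; x \<in> carrier G; y \<in> carrier G; lt x y\<rbrakk>
      \<Longrightarrow> lt (g \<otimes>\<^bsub>G\<^esub> x) (g \<otimes>\<^bsub>G\<^esub> y)"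
    using assms(2) unfolding left_orderable_def by blast
  have irr': "\<not> lt x x" if "x \<in> carrier G" for x
    using irr that by (auto dest: irreflp_onD)
  have tr': "lt x z" if "lt x y" "lt y z" "x \<in> carrier G" "y \<in> carrier G" "z \<in> carrier G" for x y z
    using tr that by (blast dest: transp_onD)
  have tot': "lt x y \<or> lt y x" if "x \<noteq> y" "x \<in> carrier G" "y \<in> carrier G" for x y
    using tot that by (blast dest: totalp_onD)
  define s :: "'a \<Rightarrow> 'a \<Rightarrow> int" where
    "s x y = (if lt x y then 1 else if lt y x then - 1 else 0)" for x y
  define c where "c x y z = s y z - s x z + s x y" for x y z
  have s_inv: "s (g \<otimes>\<^bsub>G\<^esub> x) (g \<otimes>\<^bsub>G\<^esub> y) = s x y"
    if "g \<in> carrier G" "x \<in> carrier G" "y \<in> carrier G" for g x y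
    using inv[of g x y] inv[of g y x] tot'[of x y] irr'[of "g \<otimes>\<^bsub>G\<^esub> x"]
      tr'[of "g \<otimes>\<^bsub>G\<^esub> x" "g \<otimes>\<^bsub>G\<^esub> y" "g \<otimes>\<^bsub>G\<^esub> x"] tr'[of x y x] irr'[of x] that
    by (auto simp: s_def)
  have c_val: "c x y z \<in> {-1, 0, 1} \<and> (c x y z = 0 \<longleftrightarrow> \<not> (x \<noteq> y \<and> x \<noteq> z \<and> y \<noteq> z))"
    if "x \<in> carrier G" "y \<in> carrier G" "z \<in> carrier G" for x y z
    unfolding c_def s_def using that irr' tr' tot' by (smt (verit) insertI1 insertI2)
  show ?thesis
    unfolding circularly_orderable_def
  proof (intro exI[of _ c] conjI ballI)
    \<comment> \<open>\<open>c\<close> is the coboundary of \<open>s\<close>.\<close>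
    show "c g2 g3 g4 - c g1 g3 g4 + c g1 g2 g4 - c g1 g2 g3 = 0" for g1 g2 g3 g4
      by (simp add: c_def)
  qed (use c_val s_inv in \<open>auto simp: c_def\<close>)
qed

lemma left_orderable_inj_hom:
  assumes "h \<in> hom G H" "inj_on h (carrier G)" "left_orderable H"
  shows "left_orderable G"
proof -
  obtain lt where lt: "irreflp_on (carrier H) lt" "transp_on (carrier H) lt"
      "totalp_on (carrier H) lt"
      "\<And>g x y. \<lbrakk>g \<in> carrier H; x \<in> carrier H; y \<in> carrier H; lt x y\<rbrakk>
        \<Longrightarrow> lt (g \<otimes>\<^bsub>H\<^esub> x) (g \<otimes>\<^bsub>H\<^esub> y)"
    using assms(3) unfolding left_orderable_def by blast
  have h: "h x \<in> carrier H" if "x \<in> carrier G" for x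
    using assms(1) that by (rule hom_in_carrier)
  show ?thesis
    unfolding left_orderable_def
  proof (intro exI[of _ "\<lambda>x y. lt (h x) (h y)"] conjI ballI impI)
    show "irreflp_on (carrier G) (\<lambda>x y. lt (h x) (h y))"
      using lt(1) h by (auto simp: irreflp_on_def)
    show "transp_on (carrier G) (\<lambda>x y. lt (h x) (h y))"
      using lt(2) h unfolding transp_on_def by blast
    show "totalp_on (carrier G) (\<lambda>x y. lt (h x) (h y))"
      using lt(3) h assms(2) unfolding totalp_on_def inj_on_def by blast
  qed (use lt(4) h in \<open>simp add: hom_mult[OF assms(1)]\<close>)
qed


section \<open>The central extension defined by a circular order\<close>

locale circularly_ordered_group = group G for G (structure) +
  fixes c :: "'a \<Rightarrow> 'a \<Rightarrow> 'a \<Rightarrow> int"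
  assumes c_values: "\<lbrakk>x \<in> carrier G; y \<in> carrier G; z \<in> carrier G\<rbrakk> \<Longrightarrow> c x y z \<in> {-1, 0, 1}"
    and c_eq_0_iff: "\<lbrakk>x \<in> carrier G; y \<in> carrier G; z \<in> carrier G\<rbrakk>
      \<Longrightarrow> c x y z = 0 \<longleftrightarrow> \<not> (x \<noteq> y \<and> x \<noteq> z \<and> y \<noteq> z)"
    and c_cocycle: "\<lbrakk>x \<in> carrier G; y \<in> carrier G; z \<in> carrier G; t \<in> carrier G\<rbrakk>
      \<Longrightarrow> c y z t - c x z t + c x y t - c x y z = 0"
    and c_invariant: "\<lbrakk>g \<in> carrier G; x \<in> carrier G; y \<in> carrier G; z \<in> carrier G\<rbrakk>
      \<Longrightarrow> c (g \<otimes> x) (g \<otimes> y) (g \<otimes> z) = c x y z"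
begin

text \<open>Cutting the circle open just before the point \<open>x\<close> turns the circular order into a linear
  order with least element \<open>x\<close>.\<close>

definition cut :: "'a \<Rightarrow> 'a \<Rightarrow> 'a \<Rightarrow> bool" where
  "cut x y z \<longleftrightarrow> y \<noteq> z \<and> (x = y \<or> c x y z = 1)"

lemma c_antisym:
  assumes "x \<in> carrier G" "y \<in> carrier G" "z \<in> carrier G"
  shows "c x z y = - c x y z"
  using c_cocycle[of x y z y] c_eq_0_iff[of y z y] c_eq_0_iff[of x y y] assms by simp

lemma cut_irrefl: "\<not> cut x y y"
  by (simp add: cut_def)

lemma cut_least: "\<lbrakk>x \<in> carrier G; y \<in> carrier G\<rbrakk> \<Longrightarrow> \<not> cut x y x"
  using c_eq_0_iff[of x y x] by (auto simp: cut_def)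

lemma cut_total:
  assumes "x \<in> carrier G" "y \<in> carrier G" "z \<in> carrier G" "y \<noteq> z"
  shows "cut x y z \<or> cut x z y"
  using c_values[of x y z] c_eq_0_iff[of x y z] c_antisym[of x y z] assms
  by (auto simp: cut_def)

lemma cut_trans:
  assumes "x \<in> carrier G" "y \<in> carrier G" "z \<in> carrier G" "t \<in> carrier G"
    and "cut x y z" "cut x z t"
  shows "cut x y t"
  using c_cocycle[of x y z t] c_values[of y z t] c_values[of x y t]
    c_eq_0_iff[of x y x] c_eq_0_iff[of x z x] c_antisym[of x y z] assms
  by (auto simp: cut_def)

lemma cut_asym:
  assumes "x \<in> carrier G" "y \<in> carrier G" "z \<in> carrier G" "cut x y z"
  shows "\<not> cut x z y"
  using cut_trans[of x y z y] cut_irrefl assms by blast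

lemma cut_left_mult:
  assumes "g \<in> carrier G" "x \<in> carrier G" "y \<in> carrier G" "z \<in> carrier G"
  shows "cut (g \<otimes> x) (g \<otimes> y) (g \<otimes> z) \<longleftrightarrow> cut x y z"
  using assms by (simp add: cut_def c_invariant)

text \<open>Moving the cut from \<open>x\<close> to \<open>a\<close> moves the initial segment of the elements before \<open>a\<close>
  behind all others, and keeps the order inside the two segments.\<close>

lemma cut_move:
  assumes "x \<in> carrier G" "a \<in> carrier G" "y \<in> carrier G" "z \<in> carrier G"
  shows "cut a y z \<longleftrightarrow> (if cut x y a = cut x z a then cut x y z else cut x z a)"
proof -
  have coc: "c a y z = c x y z - c x a z + c x a y"
    using c_cocycle[of x a y z] assms by simp
  have anti: "c x y a = - c x a y" "c x z a = - c x a z"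
    using c_antisym[of x a y] c_antisym[of x a z] assms by simp_all
  have vals: "c a y z = -1 \<or> c a y z = 0 \<or> c a y z = 1"
    "c x y z = -1 \<or> c x y z = 0 \<or> c x y z = 1"
    "c x a y = -1 \<or> c x a y = 0 \<or> c x a y = 1"
    "c x a z = -1 \<or> c x a z = 0 \<or> c x a z = 1"
    using c_values assms by blast+
  note zero = c_eq_0_iff[of x y z] c_eq_0_iff[of x a y] c_eq_0_iff[of x a z]
  \<comment> \<open>If points coincide, then \<open>c\<close> is \<open>0\<close> and no longer determines \<open>cut\<close>, so these cases need separate
    treatment.\<close>
  consider "x = a" | "y = z" | "y \<noteq> z" "y = a" | "y \<noteq> z" "z = a"
    | "distinct [a, y, z]" "x = y" | "distinct [a, y, z]" "x = z" | "distinct [x, a, y, z]"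
    by auto
  then show ?thesis
  proof cases
    case 3
    then show ?thesis
      using cut_total[of x a z] cut_asym[of x a z] cut_irrefl assms by (auto simp: cut_def[of a])
  next
    case 7
    then have "c x y z \<noteq> 0" "c x a y \<noteq> 0" "c x a z \<noteq> 0"
      using zero assms by simp_all
    then have "c a y z = 1 \<longleftrightarrow>
        (if (c x a y = -1) = (c x a z = -1) then c x y z = 1 else c x a z = -1)"
      using coc vals by (elim disjE) simp_all
    moreover have "c x y a = 1 \<longleftrightarrow> c x a y = -1" "c x z a = 1 \<longleftrightarrow> c x a z = -1"
      using anti by linarith+
    ultimately show ?thesis using 7 by (auto simp: cut_def)
  next
    case 5
    then have "c a y z = c x z a" using coc anti zero assms by simp
    then show ?thesis using 5 by (auto simp: cut_def)
  next
    case 6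
    then have "c a y z = - c x y a" using coc anti zero assms by simp
    moreover have "c x y a \<noteq> 0" using 6 zero assms anti by auto
    moreover have "c x y z = 0" using 6 zero assms by simp
    moreover have "c a y z = -1 \<or> c a y z = 1" using calculation vals(1) by linarith
    ultimately show ?thesis using 6 by (auto simp: cut_def)
  qed (use cut_least cut_irrefl assms in simp_all)
qed

text \<open>The inhomogeneous cocycle of the circular order: left multiplication by \<open>a\<close> carries the arc
  from \<open>\<one>\<close> forward to \<open>b\<close> to the arc from \<open>a\<close> to \<open>a \<otimes> b\<close>, which passes \<open>\<one>\<close> exactly if \<open>a \<otimes> b\<close> lies
  before \<open>a\<close>.\<close>

definition wrap :: "'a \<Rightarrow> 'a \<Rightarrow> int" where
  "wrap a b = (if cut \<one> (a \<otimes> b) a then 1 else 0)"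

text \<open>The left side counts how often the path that runs forward from \<open>g\<close> to \<open>g \<otimes> h\<close> and on to
  \<open>g \<otimes> h \<otimes> k\<close> passes \<open>\<one>\<close>.  This path is the direct one from \<open>g\<close> to \<open>g \<otimes> (h \<otimes> k)\<close>, preceded by a full
  turn exactly if \<open>wrap h k = 1\<close>, so the right side counts the same.  In the proof, \<open>cut_move\<close>
  expresses \<open>wrap h k\<close>, moved by \<open>g\<close>, in the linear order that is cut at \<open>\<one>\<close>.\<close>

lemma wrap_cocycle:
  assumes "g \<in> carrier G" "h \<in> carrier G" "k \<in> carrier G"
  shows "wrap g h + wrap (g \<otimes> h) k = wrap h k + wrap g (h \<otimes> k)"
proof -
  have "cut \<one> (h \<otimes> k) h \<longleftrightarrow> cut g (g \<otimes> h \<otimes> k) (g \<otimes> h)"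
    using cut_left_mult[of g \<one> "h \<otimes> k" h] assms by (simp add: m_assoc)
  also have "\<dots> \<longleftrightarrow> (if cut \<one> (g \<otimes> h \<otimes> k) g = cut \<one> (g \<otimes> h) g
      then cut \<one> (g \<otimes> h \<otimes> k) (g \<otimes> h) else cut \<one> (g \<otimes> h) g)"
    using assms by (intro cut_move) auto
  finally have "cut \<one> (h \<otimes> k) h \<longleftrightarrow> \<dots>" .
  moreover have "cut \<one> (g \<otimes> h \<otimes> k) g" if "cut \<one> (g \<otimes> h \<otimes> k) (g \<otimes> h)" "cut \<one> (g \<otimes> h) g"
    using cut_trans[OF _ _ _ _ that] assms by simp
  moreover have "cut \<one> (g \<otimes> h \<otimes> k) (g \<otimes> h)"
    if "cut \<one> (g \<otimes> h \<otimes> k) g" "\<not> cut \<one> (g \<otimes> h) g"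
  proof (cases "g = g \<otimes> h")
    case False
    then have "cut \<one> g (g \<otimes> h)" using cut_total[of \<one> g "g \<otimes> h"] that(2) assms by auto
    then show ?thesis using cut_trans[OF _ _ _ _ that(1)] assms by simp
  qed (use that in simp)
  ultimately show ?thesis
    using assms by (auto simp: wrap_def m_assoc)
qed

definition central_extension :: "(int \<times> 'a) monoid" where
  "central_extension = \<lparr>carrier = UNIV \<times> carrier G,
     monoid.mult = (\<lambda>(m, a) (n, b). (m + n + wrap a b, a \<otimes> b)),
     one = (0, \<one>)\<rparr>"

lemma carrier_ext [simp]: "a \<in> carrier central_extension \<longleftrightarrow> snd a \<in> carrier G"
  by (cases a) (simp add: central_extension_def)

lemma fst_mult_ext:
  "fst (a \<otimes>\<^bsub>central_extension\<^esub> b) = fst a + fst b + wrap (snd a) (snd b)"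
  by (simp add: central_extension_def split_beta)

lemma snd_mult_ext [simp]: "snd (a \<otimes>\<^bsub>central_extension\<^esub> b) = snd a \<otimes> snd b"
  by (simp add: central_extension_def split_beta)

lemma snd_one_ext [simp]: "snd \<one>\<^bsub>central_extension\<^esub> = \<one>"
  by (simp add: central_extension_def)

lemma fst_one_ext [simp]: "fst \<one>\<^bsub>central_extension\<^esub> = 0"
  by (simp add: central_extension_def)

lemma group_ext: "group central_extension"
proof (rule groupI)
  let ?mult = "(\<otimes>\<^bsub>central_extension\<^esub>)" and ?one = "\<one>\<^bsub>central_extension\<^esub>"
  show "?one \<in> carrier central_extension" by simp
  fix a assume a: "a \<in> carrier central_extension"
  show "?mult ?one a = a"
    using cut_least[of \<one> "snd a"] a by (intro prod_eqI) (simp_all add: fst_mult_ext wrap_def)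
  let ?b = "(- fst a - wrap (inv (snd a)) (snd a), inv (snd a))"
  have "?mult ?b a = ?one"
    using a by (intro prod_eqI) (simp_all add: fst_mult_ext)
  moreover have "?b \<in> carrier central_extension" using a by simp
  ultimately show "\<exists>b\<in>carrier central_extension. ?mult b a = ?one"
    by (rule bexI)
  fix b assume b: "b \<in> carrier central_extension"
  show "?mult a b \<in> carrier central_extension" using a b by simp
  fix d assume d: "d \<in> carrier central_extension"
  show "?mult (?mult a b) d = ?mult a (?mult b d)"
  proof (rule prod_eqI)
    show "fst (?mult (?mult a b) d) = fst (?mult a (?mult b d))"
      using wrap_cocycle[of "snd a" "snd b" "snd d"] a b d
      unfolding fst_mult_ext snd_mult_ext carrier_ext by linarith
    show "snd (?mult (?mult a b) d) = snd (?mult a (?mult b d))"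
      using a b d by (simp add: m_assoc)
  qed
qed

sublocale ext: group central_extension
  by (rule group_ext)

lemma snd_inv_ext [simp]:
  assumes "snd a \<in> carrier G"
  shows "snd (inv\<^bsub>central_extension\<^esub> a) = inv (snd a)"
proof -
  let ?i = "inv\<^bsub>central_extension\<^esub> a"
  have a: "a \<in> carrier central_extension" using assms by simp
  have i: "snd ?i \<in> carrier G" using ext.inv_closed[OF a] by (simp only: carrier_ext)
  have "snd (?i \<otimes>\<^bsub>central_extension\<^esub> a) = snd \<one>\<^bsub>central_extension\<^esub>"
    by (simp only: ext.l_inv[OF a])
  then have "snd ?i \<otimes> snd a = \<one>" by (simp only: snd_mult_ext snd_one_ext)
  then have "inv (snd a) = snd ?i" using assms i by (rule inv_equality)
  then show ?thesis ..
qed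

text \<open>Geometrically, \<open>\<int> \<times> carrier G\<close> in the lexicographic order is the universal cover of the
  circularly ordered set \<open>G\<close>, on which the extension acts by lifts of the left multiplications.\<close>

lemma left_orderable_ext: "left_orderable central_extension"
proof -
  define lt :: "int \<times> 'a \<Rightarrow> int \<times> 'a \<Rightarrow> bool" where
    "lt a b \<longleftrightarrow> fst a < fst b \<or> fst a = fst b \<and> cut \<one> (snd a) (snd b)" for a b
  show ?thesis
    unfolding left_orderable_def
  proof (intro exI[of _ lt] conjI ballI impI)
    show "irreflp_on (carrier central_extension) lt"
      by (auto simp: irreflp_on_def lt_def cut_irrefl)
    show "transp_on (carrier central_extension) lt"
      by (auto simp: transp_on_def lt_def intro: cut_trans)
    show "totalp_on (carrier central_extension) lt"
      using cut_total[of \<one>] by (fastforce simp: totalp_on_def lt_def prod_eq_iff)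
  next
    fix g a b
    assume "g \<in> carrier central_extension" "a \<in> carrier central_extension"
      "b \<in> carrier central_extension" and ab: "lt a b"
    then have G: "snd g \<in> carrier G" "snd a \<in> carrier G" "snd b \<in> carrier G" by auto
    let ?ga = "snd g \<otimes> snd a" and ?gb = "snd g \<otimes> snd b"
    have move: "cut \<one> (snd a) (snd b) \<longleftrightarrow>
        (if cut \<one> ?ga (snd g) = cut \<one> ?gb (snd g) then cut \<one> ?ga ?gb else cut \<one> ?gb (snd g))"
      using cut_left_mult[of "snd g" \<one> "snd a" "snd b"] cut_move[of \<one> "snd g" ?ga ?gb] G by simp
    have between: "cut \<one> ?ga ?gb" if "cut \<one> ?ga (snd g)" "\<not> cut \<one> ?gb (snd g)"
    proof (cases "snd g = ?gb")
      case False
      then have "cut \<one> (snd g) ?gb" using cut_total[of \<one> "snd g" ?gb] that(2) G by auto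
      then show ?thesis using cut_trans[OF _ _ _ _ that(1)] G by simp
    qed (use that in simp)
    show "lt (g \<otimes>\<^bsub>central_extension\<^esub> a) (g \<otimes>\<^bsub>central_extension\<^esub> b)"
      using ab move between by (auto simp: lt_def fst_mult_ext wrap_def split: if_splits)
  qed
qed

text \<open>Comparing the integer coordinates of \<open>l a\<^sup>2 = b\<^sup>2 l\<close> instead of \<open>l a = b l\<close> doubles the difference
  of \<open>a\<close> and \<open>b\<close>, while the error made by the cocycle still is at most \<open>1\<close>.  For \<open>l a = b l\<close> itself the
  error would be as large as a possible difference of \<open>a\<close> and \<open>b\<close>.\<close>

lemma ext_eq_of_conjugate:
  assumes G: "snd l \<in> carrier G" "snd a \<in> carrier G" "snd b \<in> carrier G"
    and conj: "l \<otimes>\<^bsub>central_extension\<^esub> a = b \<otimes>\<^bsub>central_extension\<^esub> l"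
    and "snd a = snd b"
  shows "a = b"
proof -
  let ?m = "(\<otimes>\<^bsub>central_extension\<^esub>)"
  have "?m l (?m a a) = ?m (?m b b) l"
    using conj G by (metis carrier_ext ext.m_assoc)
  then have "fst (?m l (?m a a)) = fst (?m (?m b b) l)" by simp
  then have "2 * (fst a - fst b)
      = wrap (snd b \<otimes> snd b) (snd l) - wrap (snd l) (snd a \<otimes> snd a)"
    using \<open>snd a = snd b\<close> by (simp add: fst_mult_ext)
  moreover have "wrap u v \<in> {0, 1}" for u v by (simp add: wrap_def)
  ultimately have "fst a = fst b" by (smt (verit) insert_iff empty_iff)
  then show ?thesis using \<open>snd a = snd b\<close> by (simp add: prod_eq_iff)
qed

end


section \<open>Homomorphisms from presented groups\<close>

primrec word_value :: "('a, 'b) monoid_scheme \<Rightarrow> ('g \<Rightarrow> 'a) \<Rightarrow> 'g word \<Rightarrow> 'a" where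
  "word_value H \<phi> [] = \<one>\<^bsub>H\<^esub>"
| "word_value H \<phi> (p # u)
    = (if snd p then \<phi> (fst p) else inv\<^bsub>H\<^esub> \<phi> (fst p)) \<otimes>\<^bsub>H\<^esub> word_value H \<phi> u"

context group
begin

lemma word_value_closed:
  assumes "\<phi> \<in> X \<rightarrow> carrier G" "u \<in> words X"
  shows "word_value G \<phi> u \<in> carrier G"
  using assms(2)
proof (induction u)
  case (Cons p u)
  then have "\<phi> (fst p) \<in> carrier G" using assms(1) by auto
  then show ?case using Cons by simp
qed simp

lemma word_value_append:
  assumes "\<phi> \<in> X \<rightarrow> carrier G" "u \<in> words X" "v \<in> words X"
  shows "word_value G \<phi> (u @ v) = word_value G \<phi> u \<otimes> word_value G \<phi> v"
  using assms(2)
proof (induction u)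
  case Nil
  then show ?case using word_value_closed[OF assms(1,3)] by simp
next
  case (Cons p u)
  then have "\<phi> (fst p) \<in> carrier G" using assms(1) by auto
  then show ?case
    using Cons word_value_closed[OF assms(1)] assms(3) by (simp add: m_assoc)
qed

lemma word_value_word_cong:
  assumes "\<phi> \<in> X \<rightarrow> carrier G"
    and rel: "\<And>l r. \<lbrakk>(l, r) \<in> R; l \<in> words X; r \<in> words X\<rbrakk> \<Longrightarrow> word_value G \<phi> l = word_value G \<phi> r"
    and "(u, v) \<in> word_cong X R"
  shows "word_value G \<phi> u = word_value G \<phi> v"
  using assms(3)
proof (induction rule: word_cong.induct)
  case (cancel x u v b)
  then have x: "\<phi> x \<in> carrier G" using assms(1) by auto
  have "word_value G \<phi> [(x, b), (x, \<not> b)] = \<one>" using x by simp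
  then show ?case
    using cancel word_value_append[OF assms(1)] word_value_closed[OF assms(1)]
    by (metis (no_types, lifting) append_Nil l_one words_simps fst_conv)
next
  case (relation l r u v)
  then show ?case using word_value_append[OF assms(1)] rel by simp
qed simp_all

lemma word_value_inv_word:
  assumes "\<phi> \<in> X \<rightarrow> carrier G" "u \<in> words X"
  shows "word_value G \<phi> (inv_word u) = inv (word_value G \<phi> u)"
proof -
  have "word_value G \<phi> (inv_word u @ u) = word_value G \<phi> []"
    by (rule word_value_word_cong[OF assms(1) _ inv_word_left[OF assms(2), of "{}"]]) simp
  then show ?thesis
    using word_value_append[OF assms(1) inv_word_in_words[OF assms(2)] assms(2)]
      word_value_closed[OF assms(1)] assms(2) inv_word_in_words[OF assms(2)]
    by (simp add: inv_equality)
qed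

text \<open>von Dyck's theorem: a map on the generators that respects the relations extends to a
  homomorphism.\<close>

lemma presented_group_hom:
  assumes "\<phi> \<in> X \<rightarrow> carrier G"
    and "\<And>l r. \<lbrakk>(l, r) \<in> R; l \<in> words X; r \<in> words X\<rbrakk> \<Longrightarrow> word_value G \<phi> l = word_value G \<phi> r"
  obtains h where "h \<in> hom (presented_group X R) G"
    and "\<And>u. u \<in> words X \<Longrightarrow> h (word_cong X R `` {u}) = word_value G \<phi> u"
proof
  define h where "h A = word_value G \<phi> (SOME u. u \<in> A)" for A
  show h: "h (word_cong X R `` {u}) = word_value G \<phi> u" if "u \<in> words X" for u
  proof -
    have "u \<in> word_cong X R `` {u}" using that by (simp add: word_cong.refl)
    then have "(SOME v. v \<in> word_cong X R `` {u}) \<in> word_cong X R `` {u}" by (rule someI)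
    then show ?thesis unfolding h_def using word_value_word_cong[OF assms] by simp
  qed
  show "h \<in> hom (presented_group X R) G"
    by (rule homI)
      (auto simp: carrier_presented_group mult_presented_group h word_value_closed[OF assms(1)]
        word_value_append[OF assms(1)])
qed

definition conj_class :: "'a \<Rightarrow> 'a set" where
  "conj_class a = (\<lambda>g. inv g \<otimes> a \<otimes> g) ` carrier G"

lemma conj_class_refl: "a \<in> carrier G \<Longrightarrow> a \<in> conj_class a"
  unfolding conj_class_def by (rule image_eqI[of _ _ \<one>]) auto

lemma conj_class_subset: "a \<in> carrier G \<Longrightarrow> conj_class a \<subseteq> carrier G"
  by (auto simp: conj_class_def)

lemma conj_class_closed:
  assumes "a \<in> carrier G" "b \<in> conj_class a" "g \<in> carrier G"
  shows "inv g \<otimes> b \<otimes> g \<in> conj_class a"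
proof -
  obtain h where h: "h \<in> carrier G" "b = inv h \<otimes> a \<otimes> h"
    using assms(2) by (auto simp: conj_class_def)
  then have "inv g \<otimes> b \<otimes> g = inv (h \<otimes> g) \<otimes> a \<otimes> (h \<otimes> g)"
    using assms by (simp add: inv_mult_group m_assoc)
  then show ?thesis using h assms by (auto simp: conj_class_def)
qed

lemma conj_class_conjugate:
  assumes "a \<in> carrier G" "b \<in> conj_class a" "d \<in> conj_class a"
  shows "\<exists>l\<in>carrier G. l \<otimes> b = d \<otimes> l"
proof -
  obtain g h where gh: "g \<in> carrier G" "b = inv g \<otimes> a \<otimes> g" "h \<in> carrier G" "d = inv h \<otimes> a \<otimes> h"
    using assms by (auto simp: conj_class_def)
  have "x \<otimes> (inv x \<otimes> y) = y" if "x \<in> carrier G" "y \<in> carrier G" for x y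
    using that by (simp flip: m_assoc)
  then have "inv h \<otimes> g \<otimes> b = d \<otimes> (inv h \<otimes> g)"
    using gh assms(1) by (simp add: m_assoc)
  then show ?thesis using gh by blast
qed

end

text \<open>Evaluating a word at the generators themselves returns its class, so a homomorphism into an
  extension is a section as soon as it lifts the generators.\<close>

lemma word_value_generators:
  assumes "u \<in> words X"
  shows "word_value (presented_group X R) (\<lambda>x. word_cong X R `` {[(x, True)]}) u
    = word_cong X R `` {u}"
  using assms
proof (induction u)
  case (Cons p u)
  let ?G = "presented_group X R" and ?gen = "\<lambda>x. word_cong X R `` {[(x, True)]}"
  interpret group ?G by (rule group_presented_group)
  obtain x b where p: "p = (x, b)" by (cases p)
  have x: "x \<in> X" using Cons.prems p by simp
  have "inv\<^bsub>?G\<^esub> ?gen x = word_cong X R `` {[(x, False)]}"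
  proof (rule inv_equality)
    show "word_cong X R `` {[(x, False)]} \<otimes>\<^bsub>?G\<^esub> ?gen x = \<one>\<^bsub>?G\<^esub>"
      using x word_cong.cancel[of x X "[]" "[]" False R]
      by (simp add: mult_presented_group one_presented_group class_eq_iff)
  qed (use x in \<open>auto simp: carrier_presented_group intro!: exI[of _ "[(x, _)]"]\<close>)
  then show ?case
    using Cons x by (cases b) (simp_all add: p mult_presented_group)
qed (simp add: one_presented_group)


section \<open>Groups with conjugate generators and conjugation relations\<close>

context circularly_ordered_group
begin

lemma inj_on_snd_conj_class:
  assumes "snd a \<in> carrier G"
  shows "inj_on snd (ext.conj_class a)"
proof (rule inj_onI)
  have a: "a \<in> carrier central_extension" using assms by simp
  fix b d assume b: "b \<in> ext.conj_class a" and d: "d \<in> ext.conj_class a" and eq: "snd b = snd d"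
  obtain l where "l \<in> carrier central_extension"
    and "l \<otimes>\<^bsub>central_extension\<^esub> b = d \<otimes>\<^bsub>central_extension\<^esub> l"
    using ext.conj_class_conjugate[OF a b d] by blast
  moreover have "b \<in> carrier central_extension" "d \<in> carrier central_extension"
    using ext.conj_class_subset[OF a] b d by blast+
  ultimately show "b = d"
    using eq by (intro ext_eq_of_conjugate[of l b d]) (simp_all only: carrier_ext)
qed

lemma conj_class_lift:
  assumes "snd a \<in> carrier G" "x \<in> conj_class (snd a)"
  obtains b where "b \<in> ext.conj_class a" "snd b = x"
proof -
  obtain g where "g \<in> carrier G" "x = inv g \<otimes> snd a \<otimes> g"
    using assms(2) by (auto simp: conj_class_def)
  then show ?thesis
    using assms(1) that[of "inv\<^bsub>central_extension\<^esub> (0, g) \<otimes>\<^bsub>central_extension\<^esub> a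
      \<otimes>\<^bsub>central_extension\<^esub> (0, g)"]
    by (auto simp: ext.conj_class_def)
qed

lemma snd_word_value_ext:
  assumes "\<phi> \<in> X \<rightarrow> carrier central_extension" "u \<in> words X"
  shows "snd (word_value central_extension \<phi> u) = word_value G (snd \<circ> \<phi>) u"
  using assms(2)
proof (induction u)
  case (Cons p u)
  then have "snd (\<phi> (fst p)) \<in> carrier G" using assms(1) by auto
  then show ?case using Cons by simp
qed simp

end

lemma circularly_orderable_imp_circularly_ordered_group:
  assumes "group G" "circularly_orderable G"
  obtains c where "circularly_ordered_group G c"
proof -
  interpret group G by fact
  obtain c :: "'a \<Rightarrow> 'a \<Rightarrow> 'a \<Rightarrow> int"
    where val: "\<forall>x\<in>carrier G. \<forall>y\<in>carrier G. \<forall>z\<in>carrier G.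
        c x y z \<in> {-1, 0, 1} \<and> (c x y z = 0 \<longleftrightarrow> \<not> (x \<noteq> y \<and> x \<noteq> z \<and> y \<noteq> z))"
      and coc: "\<forall>g1\<in>carrier G. \<forall>g2\<in>carrier G. \<forall>g3\<in>carrier G. \<forall>g4\<in>carrier G.
        c g2 g3 g4 - c g1 g3 g4 + c g1 g2 g4 - c g1 g2 g3 = 0"
      and inv: "\<forall>g\<in>carrier G. \<forall>x\<in>carrier G. \<forall>y\<in>carrier G. \<forall>z\<in>carrier G.
        c (g \<otimes>\<^bsub>G\<^esub> x) (g \<otimes>\<^bsub>G\<^esub> y) (g \<otimes>\<^bsub>G\<^esub> z) = c x y z"
    using assms(2) unfolding circularly_orderable_def by blast
  have "circularly_ordered_group G c"
    by unfold_locales (rule val[rule_format, THEN conjunct1] val[rule_format, THEN conjunct2]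
        coc[rule_format] inv[rule_format]; assumption)+
  then show ?thesis by (rule that)
qed

text \<open>Lifting all generators into one conjugacy class of the central extension turns the relations
  into equalities between members of that class, where the projection to \<open>G\<close> is injective.\<close>

theorem left_orderable_if_generators_conjugate:
  fixes X :: "'g set" and R :: "('g word \<times> 'g word) set"
  defines "G \<equiv> presented_group X R"
  assumes "circularly_orderable G" "a \<in> carrier G"
    and gens: "\<And>x. x \<in> X \<Longrightarrow> word_cong X R `` {[(x, True)]} \<in> group.conj_class G a"
    and rels: "\<And>l r. (l, r) \<in> R \<Longrightarrow>
      \<exists>x\<in>X. \<exists>y\<in>X. \<exists>v\<in>words X. l = [(x, True)] \<and> r = inv_word v @ [(y, True)] @ v"
  shows "left_orderable G"
proof -
  interpret group G unfolding G_def by (rule group_presented_group)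
  obtain c where "circularly_ordered_group G c"
    using circularly_orderable_imp_circularly_ordered_group[OF is_group assms(2)] .
  then interpret circularly_ordered_group G c .
  \<comment> \<open>The first coordinate \<open>0\<close> is arbitrary: any lift of \<open>a\<close> would do.\<close>
  let ?K = "ext.conj_class (0, a)" and ?gen = "\<lambda>x. word_cong X R `` {[(x, True)]}"
  have "\<forall>x\<in>X. \<exists>b. b \<in> ?K \<and> snd b = ?gen x"
    using conj_class_lift[of "(0, a)"] gens assms(3) by (metis snd_conv)
  then obtain \<phi> where \<phi>: "\<And>x. x \<in> X \<Longrightarrow> \<phi> x \<in> ?K" "\<And>x. x \<in> X \<Longrightarrow> snd (\<phi> x) = ?gen x"
    by metis
  have gen_closed: "?gen x \<in> carrier G" if "x \<in> X" for x
    using that by (auto simp: G_def carrier_presented_group intro!: exI[of _ "[(x, True)]"])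
  have \<phi>_closed: "\<phi> \<in> X \<rightarrow> carrier central_extension"
    using \<phi>(2) gen_closed by auto
  have snd_value: "snd (word_value central_extension \<phi> u) = word_cong X R `` {u}"
    if "u \<in> words X" for u
  proof -
    have "word_value G (snd \<circ> \<phi>) u = word_value G ?gen u"
      using that by (induction u) (auto simp: \<phi>(2))
    then show ?thesis
      using snd_word_value_ext[OF \<phi>_closed that] word_value_generators[OF that, of R]
      by (simp add: G_def)
  qed
  have "word_value central_extension \<phi> l = word_value central_extension \<phi> r"
    if lr: "(l, r) \<in> R" "l \<in> words X" "r \<in> words X" for l r
  proof -
    obtain x y v where xyv: "x \<in> X" "y \<in> X" "v \<in> words X"
      and l: "l = [(x, True)]" and r: "r = inv_word v @ [(y, True)] @ v"
      using rels[OF lr(1)] by blast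
    have \<phi>x: "\<phi> z \<in> carrier central_extension" if "z \<in> X" for z
      using \<phi>_closed that by blast
    have "word_value central_extension \<phi> l \<in> ?K"
      using \<phi>(1)[OF xyv(1)] \<phi>x[OF xyv(1)] l by (simp del: carrier_ext)
    moreover have "word_value central_extension \<phi> r \<in> ?K"
    proof -
      let ?v = "word_value central_extension \<phi> v"
      have v: "?v \<in> carrier central_extension"
        by (rule ext.word_value_closed[OF \<phi>_closed xyv(3)])
      have "word_value central_extension \<phi> r
          = inv\<^bsub>central_extension\<^esub> ?v \<otimes>\<^bsub>central_extension\<^esub> \<phi> y \<otimes>\<^bsub>central_extension\<^esub> ?v"
        unfolding r using xyv v \<phi>x[OF xyv(2)] inv_word_in_words[OF xyv(3)]
        by (simp add: ext.word_value_append[OF \<phi>_closed] ext.word_value_inv_word[OF \<phi>_closed]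
            ext.m_assoc del: carrier_ext)
      then show ?thesis
        using ext.conj_class_closed[OF _ \<phi>(1)[OF xyv(2)] v] assms(3) by simp
    qed
    moreover have "snd (word_value central_extension \<phi> l) = snd (word_value central_extension \<phi> r)"
    proof -
      have "(l, r) \<in> word_cong X R" using word_cong.relation[of l r R X "[]" "[]"] lr by simp
      then show ?thesis using lr by (simp add: snd_value class_eq_iff)
    qed
    ultimately show ?thesis
      using inj_on_snd_conj_class[of "(0, a)"] assms(3) by (auto dest: inj_onD)
  qed
  then obtain h where h: "h \<in> hom G central_extension"
    and h_class: "\<And>u. u \<in> words X \<Longrightarrow> h (word_cong X R `` {u}) = word_value central_extension \<phi> u"
    using ext.presented_group_hom[OF \<phi>_closed] unfolding G_def by blast
  have "snd (h A) = A" if A: "A \<in> carrier G" for A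
  proof -
    obtain u where "u \<in> words X" "A = word_cong X R `` {u}"
      using A unfolding G_def carrier_presented_group by blast
    then show ?thesis by (simp add: h_class snd_value)
  qed
  then have "inj_on h (carrier G)" by (rule inj_on_inverseI)
  then show ?thesis
    using left_orderable_inj_hom[OF h] left_orderable_ext by blast
qed


section \<open>Wirtinger presentations of virtual knot groups\<close>

lemma num_crossings_append [simp]: "num_crossings (u @ v) = num_crossings u + num_crossings v"
  by (simp add: num_crossings_def)

lemma ex_under_at:
  "i < num_crossings w \<Longrightarrow> \<exists>p<length w. is_under (w ! p) \<and> num_crossings (take p w) = i"
proof (induction w rule: rev_induct)
  case Nil
  then show ?case by (simp add: num_crossings_def)
next
  case (snoc a w)
  show ?case
  proof (cases "i < num_crossings w")
    case True
    then obtain p where "p < length w" "is_under (w ! p)" "num_crossings (take p w) = i"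
      using snoc.IH by blast
    then show ?thesis by (intro exI[of _ p]) (simp add: nth_append)
  next
    case False
    then have "is_under a" "i = num_crossings w"
      using snoc.prems by (auto simp: num_crossings_def split: if_splits)
    then show ?thesis by (intro exI[of _ "length w"]) (simp add: nth_append)
  qed
qed

lemma arc_at_in_arcs: "arc_at w p \<in> arcs w"
proof (cases "num_crossings w = 0")
  case True
  moreover have "num_crossings (take p w) = 0"
    using True num_crossings_append[of "take p w" "drop p w"] by simp
  ultimately show ?thesis by (simp add: arc_at_def arcs_def)
qed (simp add: arc_at_def arcs_def less_max_iff_disj)

lemma wirtinger_relation_conjugation:
  assumes "gauss_code w sgn_of" "(l, r) \<in> wirtinger_relations w sgn_of"
  shows "\<exists>x\<in>arcs w. \<exists>y\<in>arcs w. \<exists>v\<in>words (arcs w).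
    l = [(x, True)] \<and> r = inv_word v @ [(y, True)] @ v"
proof -
  obtain p q d where pqd: "p < length w" "w ! p = Under d"
    and l: "l = [letter (arc_at w (Suc p)) 1]"
    and r: "r = [letter (arc_at w q) (- sgn_of d), letter (arc_at w p) 1,
      letter (arc_at w q) (sgn_of d)]"
    using assms(2) by (auto simp: wirtinger_relations_def)
  have "Under d \<in> set w" using pqd by (metis nth_mem)
  then have "sgn_of d \<in> {1, -1}" using assms(1) by (simp add: gauss_code_def)
  then have "r = inv_word [letter (arc_at w q) (sgn_of d)] @ [(arc_at w p, True)]
      @ [letter (arc_at w q) (sgn_of d)]"
    by (auto simp: r inv_word_def letter_def)
  then show ?thesis
    using arc_at_in_arcs l
    by (intro bexI[of _ "arc_at w (Suc p)"] bexI[of _ "arc_at w p"]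
        bexI[of _ "[letter (arc_at w q) (sgn_of d)]"]) (auto simp: letter_def)
qed

text \<open>The under-crossing that separates arc \<open>i\<close> from arc \<open>i + 1\<close> makes their generators conjugate.
  Going along the knot from arc \<open>0\<close> up to the last arc, without closing up, reaches every
  generator.\<close>

lemma wirtinger_relation_next_arc:
  assumes "gauss_code w sgn_of" "Suc i < num_crossings w"
  shows "\<exists>v\<in>words (arcs w).
    ([(Suc i, True)], inv_word v @ [(i, True)] @ v) \<in> wirtinger_relations w sgn_of"
proof -
  obtain p where p: "p < length w" "is_under (w ! p)" "num_crossings (take p w) = i"
    using ex_under_at[of i w] assms(2) by auto
  then obtain d where d: "w ! p = Under d" by (cases "w ! p") auto
  then have "Under d \<in> set w" using p by (metis nth_mem)
  then have "Over d \<in> set w" and sgn: "sgn_of d \<in> {1, -1}"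
    using assms(1) by (auto simp: gauss_code_def)
  then obtain q where q: "q < length w" "w ! q = Over d" by (auto simp: in_set_conv_nth)
  have "num_crossings (take (Suc p) w) = Suc i"
    using p by (simp add: take_Suc_conv_app_nth) (simp add: num_crossings_def)
  then have arcs_p: "arc_at w p = i" "arc_at w (Suc p) = Suc i"
    using assms(2) p by (simp_all add: arc_at_def)
  let ?v = "[letter (arc_at w q) (sgn_of d)]"
  have "([letter (arc_at w (Suc p)) 1], [letter (arc_at w q) (- sgn_of d), letter (arc_at w p) 1,
      letter (arc_at w q) (sgn_of d)]) \<in> wirtinger_relations w sgn_of"
    using p q d by (auto simp: wirtinger_relations_def)
  also have "([letter (arc_at w (Suc p)) 1], [letter (arc_at w q) (- sgn_of d),
      letter (arc_at w p) 1, letter (arc_at w q) (sgn_of d)])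
      = ([(Suc i, True)], inv_word ?v @ [(i, True)] @ ?v)"
    using sgn arcs_p by (auto simp: inv_word_def letter_def)
  finally show ?thesis
    by (rule bexI) (use arc_at_in_arcs in \<open>simp add: letter_def\<close>)
qed

lemma meridians_conjugate:
  assumes "gauss_code w sgn_of" "i \<in> arcs w"
  shows "word_cong (arcs w) (wirtinger_relations w sgn_of) `` {[(i, True)]} \<in>
    group.conj_class (virtual_knot_group w sgn_of)
      (word_cong (arcs w) (wirtinger_relations w sgn_of) `` {[(0, True)]})"
proof -
  let ?X = "arcs w" and ?R = "wirtinger_relations w sgn_of"
  let ?cl = "\<lambda>u. word_cong ?X ?R `` {u}" and ?G = "virtual_knot_group w sgn_of"
  let ?gen = "\<lambda>x. ?cl [(x, True)]"
  interpret group ?G unfolding virtual_knot_group_def by (rule group_presented_group)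
  have cl: "?cl u \<in> carrier ?G" if "u \<in> words ?X" for u
    using that by (auto simp: virtual_knot_group_def carrier_presented_group)
  have gen: "?gen \<in> ?X \<rightarrow> carrier ?G" by (auto intro: cl)
  have zero: "0 \<in> ?X" by (simp add: arcs_def)
  have cl_value: "word_value ?G ?gen u = ?cl u" if "u \<in> words ?X" for u
    using word_value_generators[OF that] by (simp add: virtual_knot_group_def)
  show ?thesis
    using assms(2)
  proof (induction i)
    case 0
    show ?case by (rule conj_class_refl) (simp add: cl zero)
  next
    case (Suc i)
    then have i: "i \<in> ?X" and "Suc i < num_crossings w" by (auto simp: arcs_def)
    then obtain v where v: "v \<in> words ?X"
      and rel: "([(Suc i, True)], inv_word v @ [(i, True)] @ v) \<in> ?R"
      using wirtinger_relation_next_arc[OF assms(1)] by blast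
    have v': "inv_word v \<in> words ?X" by (rule inv_word_in_words[OF v])
    have "([(Suc i, True)], inv_word v @ [(i, True)] @ v) \<in> word_cong ?X ?R"
      using word_cong.relation[OF rel, of ?X "[]" "[]"] v v' i Suc.prems by simp
    then have "?gen (Suc i) = ?cl (inv_word v @ [(i, True)] @ v)"
      using v v' i Suc.prems by (subst class_eq_iff) auto
    also have "\<dots> = ?cl (inv_word v) \<otimes>\<^bsub>?G\<^esub> ?gen i \<otimes>\<^bsub>?G\<^esub> ?cl v"
      using v v' i by (simp add: virtual_knot_group_def mult_presented_group)
    also have "?cl (inv_word v) = inv\<^bsub>?G\<^esub> ?cl v"
      using word_value_inv_word[OF gen v] cl_value[OF v] cl_value[OF v'] by simp
    finally show ?case
      using conj_class_closed[OF _ Suc.IH[OF i] cl[OF v]] cl zero by simp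
  qed
qed

theorem theorem7p7:
  fixes w :: "'c passage list" and sgn_of :: "'c \<Rightarrow> int"
  assumes "gauss_code w sgn_of"
  shows "left_orderable (virtual_knot_group w sgn_of)
    \<longleftrightarrow> circularly_orderable (virtual_knot_group w sgn_of)"
proof
  show "circularly_orderable (virtual_knot_group w sgn_of)"
    if "left_orderable (virtual_knot_group w sgn_of)"
    using left_orderable_imp_circularly_orderable[OF group_presented_group] that
    unfolding virtual_knot_group_def by blast
next
  let ?a = "word_cong (arcs w) (wirtinger_relations w sgn_of) `` {[(0, True)]}"
  assume "circularly_orderable (virtual_knot_group w sgn_of)"
  moreover have "?a \<in> carrier (virtual_knot_group w sgn_of)"
    by (auto simp: virtual_knot_group_def carrier_presented_group arcs_def
        intro!: exI[of _ "[(0, True)]"])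
  ultimately show "left_orderable (virtual_knot_group w sgn_of)"
    unfolding virtual_knot_group_def
    by (rule left_orderable_if_generators_conjugate)
      (use meridians_conjugate[OF assms] wirtinger_relation_conjugation[OF assms]
        in \<open>auto simp: virtual_knot_group_def\<close>)
qed

end
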